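(* Let $S_1$ and $S_2$ be the irreducible hypersurfaces of $\mathbb{C}^3$ (with coordinates $x_1, y, z$) defined by the equations $$x_1^2 y + z^2 + x_1 z^2 = 0 \qquad\text{and}\qquad x_1^2 y + z^2 + x_1 = 0,$$ respectively. Let $m' \geq 0$ be any nonnegative integer and consider the hypersurfaces $H'_1 = S_1 \times \mathbb{C}^{m'}$ and $H'_2 = S_2 \times \mathbb{C}^{m'}$ in $\mathbb{C}^{m'+3}$. Then the complements $\mathbb{C}^{m'+3} \setminus H'_1$ and $\mathbb{C}^{m'+3} \setminus H'_2$ are isomorphic. However, $H'_1$ is singular and $H'_2$ is smooth, and hence $H'_1$ and $H'_2$ are not biholomorphic.
   Context: Hypersurfaces are algebraic, i.e. zero sets of polynomials with complex coefficients. "Isomorphic" means isomorphic as complex algebraic varieties; "biholomorphic" means isomorphic as complex analytic spaces. The complement of a hypersurface in affine space is regarded as an (affine) algebraic variety. *)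

theory Defs
  imports "HOL-Analysis.Analysis"
begin

(* Polynomials in the coordinates of complex^'n are identified with the functions they induce
   (harmless, the field of complex numbers being infinite); compare real_polynomial_function. *)

inductive complex_polynomial_function :: "(complex ^ 'n \<Rightarrow> complex) \<Rightarrow> bool" where
  coordinate: "complex_polynomial_function (\<lambda>x. x $ i)"
| const: "complex_polynomial_function (\<lambda>x. c)"
| add: "complex_polynomial_function f \<Longrightarrow> complex_polynomial_function g
    \<Longrightarrow> complex_polynomial_function (\<lambda>x. f x + g x)"
| mult: "complex_polynomial_function f \<Longrightarrow> complex_polynomial_function g
    \<Longrightarrow> complex_polynomial_function (\<lambda>x. f x * g x)"

definition algebraic_set :: "(complex ^ 'n) set \<Rightarrow> bool" where
  "algebraic_set V \<longleftrightarrow>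
    (\<exists>F. (\<forall>f\<in>F. complex_polynomial_function f) \<and> V = {x. \<forall>f\<in>F. f x = 0})"

definition irreducible_algebraic_set :: "(complex ^ 'n) set \<Rightarrow> bool" where
  "irreducible_algebraic_set V \<longleftrightarrow> algebraic_set V \<and> V \<noteq> {} \<and>
    (\<forall>A B. algebraic_set A \<and> algebraic_set B \<and> V = A \<union> B \<longrightarrow> V = A \<or> V = B)"

definition hypersurface :: "(complex ^ 'n) set \<Rightarrow> bool" where
  "hypersurface V \<longleftrightarrow>
    (\<exists>f. complex_polynomial_function f \<and> (\<nexists>c. f = (\<lambda>x. c)) \<and> V = {x. f x = 0})"

definition vanishing_ideal :: "(complex ^ 'n) set \<Rightarrow> (complex ^ 'n \<Rightarrow> complex) set" where
  "vanishing_ideal V = {f. complex_polynomial_function f \<and> (\<forall>x\<in>V. f x = 0)}"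

definition partial_deriv :: "'n \<Rightarrow> (complex ^ 'n::finite \<Rightarrow> complex) \<Rightarrow> complex ^ 'n \<Rightarrow> complex" where
  "partial_deriv i f p = deriv (\<lambda>t. f (p + t *s axis i 1)) 0"

definition zariski_tangent_space :: "(complex ^ 'n::finite) set \<Rightarrow> complex ^ 'n \<Rightarrow> (complex ^ 'n) set" where
  "zariski_tangent_space V p =
    {v. \<forall>f\<in>vanishing_ideal V. (\<Sum>i\<in>UNIV. partial_deriv i f p * v $ i) = 0}"

(* Meant for hypersurfaces only: these have dimension CARD('n) - 1 at each of their points,
   so a point is smooth exactly when the (complex) dimension vec.dim of the Zariski tangent
   space has that value. The full vanishing ideal is used, i.e. the reduced structure. *)

definition singular_point :: "(complex ^ 'n::finite) set \<Rightarrow> complex ^ 'n \<Rightarrow> bool" where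
  "singular_point V p \<longleftrightarrow> p \<in> V \<and> vec.dim (zariski_tangent_space V p) \<noteq> CARD('n) - 1"

definition singular_hypersurface :: "(complex ^ 'n::finite) set \<Rightarrow> bool" where
  "singular_hypersurface V \<longleftrightarrow> hypersurface V \<and> (\<exists>p. singular_point V p)"

definition smooth_hypersurface :: "(complex ^ 'n::finite) set \<Rightarrow> bool" where
  "smooth_hypersurface V \<longleftrightarrow> hypersurface V \<and> (\<nexists>p. singular_point V p)"

(* Regular functions, morphisms and isomorphisms of quasi-affine varieties, i.e. of Zariski
   locally closed subsets U of affine space: a regular function on U is locally, in the
   Zariski topology of U, a quotient of polynomials. *)

definition regular_function_on :: "(complex ^ 'n) set \<Rightarrow> (complex ^ 'n \<Rightarrow> complex) \<Rightarrow> bool" where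
  "regular_function_on U f \<longleftrightarrow>
    (\<forall>p\<in>U. \<exists>g h. complex_polynomial_function g \<and> complex_polynomial_function h \<and> h p \<noteq> 0 \<and>
      (\<forall>x\<in>U. h x \<noteq> 0 \<longrightarrow> f x = g x / h x))"

definition algebraic_morphism ::
    "(complex ^ 'n) set \<Rightarrow> (complex ^ 'k) set \<Rightarrow> (complex ^ 'n \<Rightarrow> complex ^ 'k) \<Rightarrow> bool" where
  "algebraic_morphism U W \<phi> \<longleftrightarrow> \<phi> ` U \<subseteq> W \<and> (\<forall>i. regular_function_on U (\<lambda>x. \<phi> x $ i))"

definition isomorphic_varieties :: "(complex ^ 'n) set \<Rightarrow> (complex ^ 'k) set \<Rightarrow> bool" where
  "isomorphic_varieties U W \<longleftrightarrow>
    (\<exists>\<phi> \<psi>. algebraic_morphism U W \<phi> \<and> algebraic_morphism W U \<psi> \<and>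
      (\<forall>x\<in>U. \<psi> (\<phi> x) = x) \<and> (\<forall>y\<in>W. \<phi> (\<psi> y) = y))"

(* Holomorphic maps between open subsets of affine spaces (has_derivative is real-linear, hence
   the extra condition), and between closed analytic subsets X, Y with their reduced analytic
   structure: locally restrictions of holomorphic maps of the ambient space. *)

definition holomorphic_map_on ::
    "(complex ^ 'n::finite) set \<Rightarrow> (complex ^ 'n \<Rightarrow> complex ^ 'k::finite) \<Rightarrow> bool" where
  "holomorphic_map_on U F \<longleftrightarrow>
    (\<forall>x\<in>U. \<exists>D. (F has_derivative D) (at x) \<and> (\<forall>c v. D (c *s v) = c *s D v))"

definition analytic_morphism ::
    "(complex ^ 'n::finite) set \<Rightarrow> (complex ^ 'k::finite) set \<Rightarrow> (complex ^ 'n \<Rightarrow> complex ^ 'k) \<Rightarrow> bool" where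
  "analytic_morphism X Y f \<longleftrightarrow> f ` X \<subseteq> Y \<and>
    (\<forall>p\<in>X. \<exists>U F. open U \<and> p \<in> U \<and> holomorphic_map_on U F \<and> (\<forall>x\<in>X \<inter> U. f x = F x))"

definition biholomorphic :: "(complex ^ 'n::finite) set \<Rightarrow> (complex ^ 'k::finite) set \<Rightarrow> bool" where
  "biholomorphic X Y \<longleftrightarrow>
    (\<exists>f g. analytic_morphism X Y f \<and> analytic_morphism Y X g \<and>
      (\<forall>x\<in>X. g (f x) = x) \<and> (\<forall>y\<in>Y. f (g y) = y))"

(* The coordinates (x_1, y, z) of complex^3 are x $ 1, x $ 2, x $ 3. *)

definition S1 :: "(complex ^ 3) set" where
  "S1 = {x. (x $ 1)^2 * x $ 2 + (x $ 3)^2 + x $ 1 * (x $ 3)^2 = 0}"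

definition S2 :: "(complex ^ 3) set" where
  "S2 = {x. (x $ 1)^2 * x $ 2 + (x $ 3)^2 + x $ 1 = 0}"

(* The product of S with the affine space on the coordinates outside the range of the injection
   \<iota>, which selects three of the coordinates of complex^'n. This covers the case of no further
   coordinates, for which a product type would need an empty index type. *)

definition cylinder :: "(3 \<Rightarrow> 'n) \<Rightarrow> (complex ^ 3) set \<Rightarrow> (complex ^ 'n) set" where
  "cylinder \<iota> S = {x. (\<chi> i. x $ \<iota> i) \<in> S}"

end

theory Submission
  imports Defs "HOL-Computational_Algebra.Polynomial"
begin

text \<open>
  Write \<open>f1\<close> and \<open>f2\<close> for the defining polynomials of \<open>S1\<close> and \<open>S2\<close>.

  The complements are isomorphic because for each \<open>c \<noteq> 0\<close> the fibres \<open>f1 = c\<close> and \<open>f2 = c\<close> are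
  isomorphic, by maps that depend algebraically on \<open>c\<close> and \<open>1 / c\<close>. On the fibre \<open>f2 = c\<close> put
  \<open>x = c X\<close>; then \<open>X^2 (c^2 y) = c (1 - X) - z^2\<close>. The fibre \<open>f1 = c\<close> is
  \<open>X^2 Y = c - (1 + X) z^2\<close>. Since \<open>(1 - X) (1 + X) = 1\<close> modulo \<open>X^2\<close>, multiplication
  by \<open>1 - X\<close> turns \<open>c - (1 + X) z^2\<close> into \<open>c (1 - X) - z^2\<close> modulo \<open>X^2\<close>, and multiplication
  by \<open>1 + X\<close> goes back. The multiples of \<open>X^2\<close> that are left over are absorbed in the coordinate
  multiplied by \<open>X^2\<close>, whence \<open>c^2 y = (1 - X) Y - z^2\<close> and \<open>Y = (1 + X) c^2 y + c\<close>.
  Letting \<open>c\<close> be the value of \<open>f1\<close> or \<open>f2\<close> gives the two mutually inverse maps in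
  \<open>isomorphic_complements\<close>.

  Everything about tangent spaces rests on velocities of holomorphic arcs in the set \<open>V\<close>.
  They lie in the Zariski tangent space (\<open>span_velocities_tangent\<close>), because a polynomial that
  vanishes on \<open>V\<close> vanishes along the arc; so this space is bounded from below without knowing
  generators of the vanishing ideal. The surface \<open>S1\<close> crosses itself along the line
  \<open>x = z = 0\<close>: the two branches through \<open>(0, -1, 0)\<close>, with the line itself, have velocities
  spanning the whole space (\<open>span_velocities_S1\<close>). On \<open>S2\<close> every vector in the kernel of the
  differential of \<open>f2\<close>, which is nowhere zero, is a velocity (\<open>kernel_subset_velocities_S2\<close>),
  so that every tangent space is a hyperplane. Both facts pass to the cylinders.

  An analytic isomorphism maps arcs to arcs, and its differential is inverted, on velocities, by
  that of its inverse. Hence a point at which velocities span the ambient space is mapped to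
  another such point (\<open>biholomorphic_full_tangent_space\<close>), and the smooth cylinder over \<open>S2\<close>
  has none.

  Irreducibility holds because any two points of either surface lie on a rational curve in the
  surface, and polynomials in one variable have no zero divisors
  (\<open>irreducible_if_joined_by_rational_curves\<close>). The curves are images of lines under the
  parametrizations \<open>S1_parametrized\<close> and \<open>S2_parametrized\<close>.
\<close>

section \<open>Arcs and the Zariski tangent space\<close>

text \<open>The derivative of \<open>\<gamma>\<close> is required at the parameter 0 only, and it is complex linear, so that
  \<open>v\<close> is the complex velocity there. Membership in \<open>V\<close> is asked for small parameters only,
  since arcs given by rational functions have poles.\<close>

definition arc_in ::
    "(complex ^ 'n::finite) set \<Rightarrow> complex ^ 'n \<Rightarrow> complex ^ 'n \<Rightarrow> (complex \<Rightarrow> complex ^ 'n) \<Rightarrow> bool" where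
  "arc_in V p v \<gamma> \<longleftrightarrow> \<gamma> 0 = p \<and> eventually (\<lambda>t. \<gamma> t \<in> V) (nhds 0) \<and>
    (\<gamma> has_derivative (\<lambda>h. h *s v)) (at 0)"

definition velocities :: "(complex ^ 'n::finite) set \<Rightarrow> complex ^ 'n \<Rightarrow> (complex ^ 'n) set" where
  "velocities V p = {v. \<exists>\<gamma>. arc_in V p v \<gamma>}"

lemma has_derivative_vec_componentwise:
  fixes \<gamma> :: "complex \<Rightarrow> complex ^ 'n::finite"
  assumes "\<And>i. ((\<lambda>t. \<gamma> t $ i) has_field_derivative v $ i) (at t0)"
  shows "(\<gamma> has_derivative (\<lambda>h. h *s v)) (at t0)"
proof -
  have sum_axis: "x = (\<Sum>i\<in>UNIV. axis i (x $ i))" for x :: "complex ^ 'n"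
    by (simp add: vec_eq_iff axis_def if_distrib cong: if_cong)
  have lin: "bounded_linear (axis i :: complex \<Rightarrow> complex ^ 'n)" for i
    by (simp add: linear_conv_bounded_linear[symmetric] linear_iff vec_eq_iff axis_def)
  have "((\<lambda>t. \<Sum>i\<in>UNIV. axis i (\<gamma> t $ i)) has_derivative
      (\<lambda>h. \<Sum>i\<in>UNIV. axis i (v $ i * h))) (at t0)"
    by (intro has_derivative_sum bounded_linear.has_derivative[OF lin]
        assms[unfolded has_field_derivative_def])
  moreover have "(\<lambda>t. \<Sum>i\<in>UNIV. axis i (\<gamma> t $ i)) = \<gamma>"
    by (rule ext) (rule sum_axis[symmetric])
  moreover have "(\<lambda>h. \<Sum>i\<in>UNIV. axis i (v $ i * h)) = (\<lambda>h. h *s v)"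
  proof
    fix h show "(\<Sum>i\<in>UNIV. axis i (v $ i * h)) = h *s v"
      using sum_axis[of "h *s v"] by (simp add: mult.commute)
  qed
  ultimately show ?thesis by simp
qed

lemma arc_inI:
  assumes "\<gamma> 0 = p" "eventually (\<lambda>t. \<gamma> t \<in> V) (nhds 0)"
    and "\<And>i. ((\<lambda>t. \<gamma> t $ i) has_field_derivative v $ i) (at 0)"
  shows "arc_in V p v \<gamma>"
  using assms has_derivative_vec_componentwise unfolding arc_in_def by blast

lemma arc_in_vector_3I:
  fixes v :: "complex ^ 3"
  assumes "vector [x 0, y 0, z 0] = p" "eventually (\<lambda>t. vector [x t, y t, z t] \<in> V) (nhds 0)"
    and "(x has_field_derivative v $ 1) (at 0)" "(y has_field_derivative v $ 2) (at 0)"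
    and "(z has_field_derivative v $ 3) (at 0)"
  shows "arc_in V p v (\<lambda>t. vector [x t, y t, z t])"
proof (rule arc_inI)
  have "\<forall>i. ((\<lambda>t. (vector [x t, y t, z t] :: complex ^ 3) $ i) has_field_derivative v $ i) (at 0)"
    unfolding forall_3 vector_3 using assms by blast
  then show "((\<lambda>t. (vector [x t, y t, z t] :: complex ^ 3) $ i) has_field_derivative v $ i) (at 0)" for i
    by blast
qed (use assms in blast)+

text \<open>The product and sum rules give some coefficients for the differential; restriction to the
  coordinate lines identifies them with the partial derivatives.\<close>

lemma complex_polynomial_function_has_derivative:
  fixes f :: "complex ^ 'n::finite \<Rightarrow> complex"
  assumes "complex_polynomial_function f"
  shows "(f has_derivative (\<lambda>v. \<Sum>i\<in>UNIV. partial_deriv i f p * v $ i)) (at p)"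
proof -
  from assms have "\<exists>g. (f has_derivative (\<lambda>v. \<Sum>i\<in>UNIV. g i * v $ i)) (at p)"
  proof induction
    case (coordinate i)
    have "((\<lambda>x. x $ i) has_derivative (\<lambda>v. v $ i)) (at p)"
      by (rule bounded_linear_imp_has_derivative) (rule bounded_linear_vec_nth)
    moreover have "(\<lambda>v :: complex ^ 'n. v $ i) = (\<lambda>v. \<Sum>j\<in>UNIV. (if j = i then 1 else 0) * v $ j)"
      by (simp add: if_distrib[of "\<lambda>c. c * _"] cong: if_cong)
    ultimately show ?case by (auto intro: exI[of _ "\<lambda>j. if j = i then 1 else 0"])
  next
    case (const c)
    then show ?case by (auto intro!: exI[of _ "\<lambda>_. 0"] derivative_eq_intros)
  next
    case (add f g)
    then obtain a b where
      "(f has_derivative (\<lambda>v. \<Sum>i\<in>UNIV. a i * v $ i)) (at p)"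
      "(g has_derivative (\<lambda>v. \<Sum>i\<in>UNIV. b i * v $ i)) (at p)" by blast
    from has_derivative_add[OF this] show ?case
      by (auto intro!: exI[of _ "\<lambda>i. a i + b i"] simp: sum.distrib distrib_right)
  next
    case (mult f g)
    then obtain a b where
      "(f has_derivative (\<lambda>v. \<Sum>i\<in>UNIV. a i * v $ i)) (at p)"
      "(g has_derivative (\<lambda>v. \<Sum>i\<in>UNIV. b i * v $ i)) (at p)" by blast
    from has_derivative_mult[OF this] show ?case
      by (auto intro!: exI[of _ "\<lambda>i. f p * b i + a i * g p"]
          simp: sum.distrib distrib_left distrib_right sum_distrib_left sum_distrib_right mult_ac)
  qed
  then obtain g where g: "(f has_derivative (\<lambda>v. \<Sum>i\<in>UNIV. g i * v $ i)) (at p)" ..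
  have "partial_deriv i f p = g i" for i
  proof -
    have "((\<lambda>t. p + t *s axis i 1) has_derivative (\<lambda>h. h *s axis i 1)) (at 0)"
      by (rule has_derivative_vec_componentwise) (auto intro!: derivative_eq_intros)
    from has_derivative_compose[OF this, of f "\<lambda>v. \<Sum>i\<in>UNIV. g i * v $ i"] g
    have "((\<lambda>t. f (p + t *s axis i 1)) has_derivative
        (\<lambda>h. \<Sum>j\<in>UNIV. g j * (h *s axis i 1) $ j)) (at 0)" by simp
    moreover have "(\<lambda>h. \<Sum>j\<in>UNIV. g j * (h *s axis i 1 :: complex ^ 'n) $ j) = (\<lambda>h. g i * h)"
      by (simp add: axis_def if_distrib[of "\<lambda>c. _ * c"] cong: if_cong)
    ultimately have "((\<lambda>t. f (p + t *s axis i 1)) has_field_derivative g i) (at 0)"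
      by (simp add: has_field_derivative_def)
    then show ?thesis unfolding partial_deriv_def by (rule DERIV_imp_deriv)
  qed
  with g show ?thesis by simp
qed

lemma differential_eqI:
  assumes "complex_polynomial_function f" "(f has_derivative D) (at p)"
  shows "(\<Sum>i\<in>UNIV. partial_deriv i f p * v $ i) = D v"
  using has_derivative_unique[OF complex_polynomial_function_has_derivative[OF assms(1)] assms(2)]
  by (rule fun_cong)

lemma subspace_hyperplane:
  "vec.subspace {v :: complex ^ 'n::finite. (\<Sum>i\<in>UNIV. g i * v $ i) = 0}"
  by (simp add: vec.subspace_def sum.distrib distrib_left sum_distrib_left[symmetric] mult.left_commute)

text \<open>Adding one vector outside the kernel of a linear form spans the whole space.\<close>

lemma dim_hyperplane:
  fixes g :: "'n::finite \<Rightarrow> complex"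
  assumes "(\<Sum>i\<in>UNIV. g i * u $ i) \<noteq> 0"
  shows "vec.dim {v :: complex ^ 'n. (\<Sum>i\<in>UNIV. g i * v $ i) = 0} = CARD('n) - 1"
proof -
  let ?l = "\<lambda>v :: complex ^ 'n. \<Sum>i\<in>UNIV. g i * v $ i"
  let ?K = "{v. ?l v = 0}"
  have span_K: "vec.span ?K = ?K"
    by (simp add: vec.span_eq_iff subspace_hyperplane)
  have "v \<in> vec.span (insert u ?K)" for v
  proof -
    let ?c = "?l v / ?l u"
    have "?l (v - c *s u) = ?l v - c * ?l u" for c
      by (simp add: sum_subtractf right_diff_distrib sum_distrib_left mult_ac)
    from this[of ?c] assms have "?l (v - ?c *s u) = 0"
      by (simp only: nonzero_eq_divide_eq nonzero_divide_eq_eq) simp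
    then have "v - ?c *s u \<in> ?K" by blast
    then show ?thesis unfolding vec.span_insert span_K by blast
  qed
  then have "vec.span (insert u ?K) = UNIV" by blast
  then have "vec.dim (insert u ?K) = CARD('n)"
    by (metis vec.dim_span vec_dim_card)
  moreover have "vec.dim (insert u ?K) = vec.dim ?K + 1"
    unfolding vec.dim_insert span_K using assms by simp
  ultimately show ?thesis by simp
qed

lemma velocity_in_tangent_space: "velocities V p \<subseteq> zariski_tangent_space V p"
proof
  fix v assume "v \<in> velocities V p"
  then obtain \<gamma> where \<gamma>: "arc_in V p v \<gamma>" unfolding velocities_def by blast
  show "v \<in> zariski_tangent_space V p" unfolding zariski_tangent_space_def
  proof (clarify)
    fix f assume f: "f \<in> vanishing_ideal V"
    let ?D = "\<lambda>v. \<Sum>i\<in>UNIV. partial_deriv i f p * v $ i"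
    have "complex_polynomial_function f" using f by (simp add: vanishing_ideal_def)
    then have f': "(f has_derivative ?D) (at p)"
      by (rule complex_polynomial_function_has_derivative)
    have \<gamma>0: "\<gamma> 0 = p" and \<gamma>': "(\<gamma> has_derivative (\<lambda>h. h *s v)) (at 0)"
      using \<gamma> by (simp_all only: arc_in_def)
    have d: "((\<lambda>t. f (\<gamma> t)) has_derivative (\<lambda>h. ?D (h *s v))) (at 0)"
      using has_derivative_compose[OF \<gamma>', of f ?D] f' by (simp only: \<gamma>0)
    have "eventually (\<lambda>t. f (\<gamma> t) = 0) (nhds 0)"
      using \<gamma> f unfolding arc_in_def vanishing_ideal_def by (auto elim: eventually_mono)
    then obtain S where "open S" "0 \<in> S" "\<And>t. t \<in> S \<Longrightarrow> f (\<gamma> t) = 0"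
      unfolding eventually_nhds by blast
    then have "((\<lambda>t. 0) has_derivative (\<lambda>h. ?D (h *s v))) (at (0::complex))"
      by (rule has_derivative_transform_within_open[OF d])
    from has_derivative_unique[OF this has_derivative_const]
    have "?D (1 *s v) = 0" by (rule fun_cong)
    then show "?D v = 0" by simp
  qed
qed

lemma subspace_tangent_space: "vec.subspace (zariski_tangent_space V p)"
proof -
  have "zariski_tangent_space V p =
      \<Inter> ((\<lambda>f. {v. (\<Sum>i\<in>UNIV. partial_deriv i f p * v $ i) = 0}) ` vanishing_ideal V)"
    unfolding zariski_tangent_space_def by auto
  also have "vec.subspace \<dots>" 
    by (rule vec.subspace_Inter) (auto intro: subspace_hyperplane)
  finally show ?thesis .
qed

lemma span_velocities_tangent: "vec.span (velocities V p) \<subseteq> zariski_tangent_space V p"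
  by (intro vec.span_minimal velocity_in_tangent_space subspace_tangent_space)

lemma singular_if_tangent_UNIV:
  fixes V :: "(complex ^ 'n::finite) set"
  assumes "p \<in> V" "zariski_tangent_space V p = UNIV"
  shows "singular_point V p"
  unfolding singular_point_def assms(2) vec_dim_card
  using assms(1) zero_less_card_finite[where 'a = 'n] by linarith

text \<open>The differential of a single equation bounds the Zariski tangent space from above, the
  velocities bound it from below. When the two bounds agree, it is a hyperplane.\<close>

lemma nonsingular_if_kernel_velocities:
  fixes V :: "(complex ^ 'n::finite) set"
  assumes f: "f \<in> vanishing_ideal V" 
    and D: "(f has_derivative D) (at p)" "D u \<noteq> 0"
    and vel: "\<And>v. D v = 0 \<Longrightarrow> v \<in> velocities V p"
  shows "\<not> singular_point V p"
proof -
  let ?K = "{v :: complex ^ 'n. (\<Sum>i\<in>UNIV. partial_deriv i f p * v $ i) = 0}"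
  have D_eq: "(\<Sum>i\<in>UNIV. partial_deriv i f p * v $ i) = D v" for v
    using f D(1) by (intro differential_eqI) (auto simp: vanishing_ideal_def)
  have "zariski_tangent_space V p = ?K"
    using f vel velocity_in_tangent_space[of V p]
    by (auto simp: zariski_tangent_space_def D_eq)
  moreover have "vec.dim ?K = CARD('n) - 1"
    by (rule dim_hyperplane[of _ u]) (simp add: D_eq D(2))
  ultimately show ?thesis by (simp add: singular_point_def)
qed

section \<open>Analytic maps push arcs forward\<close>

text \<open>An analytic map has no derivative of its own on \<open>X\<close>; the linear map here is the derivative of a
  local holomorphic extension.\<close>

lemma arc_push_forward:
  fixes f :: "complex ^ 'n::finite \<Rightarrow> complex ^ 'k::finite"
  assumes f: "analytic_morphism X Y f" and p: "p \<in> X"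
  shows "\<exists>D. Vector_Spaces.linear (*s) (*s) D \<and>
    (\<forall>\<gamma> v. arc_in X p v \<gamma> \<longrightarrow> arc_in Y (f p) (D v) (\<lambda>t. f (\<gamma> t)))"
proof -
  from f p obtain U F where U: "open U" "p \<in> U" and hol: "holomorphic_map_on U F"
    and fF: "\<And>x. x \<in> X \<inter> U \<Longrightarrow> f x = F x"
    unfolding analytic_morphism_def by metis
  from hol U obtain D where D: "(F has_derivative D) (at p)" and Dc: "\<And>c v. D (c *s v) = c *s D v"
    unfolding holomorphic_map_on_def by blast
  have "Vector_Spaces.linear (*s) (*s) D"
    using linear_add[OF has_derivative_linear[OF D]] Dc
    by (simp add: Vector_Spaces.linear_iff vec.vector_space_axioms)
  moreover have "arc_in Y (f p) (D v) (\<lambda>t. f (\<gamma> t))" if \<gamma>: "arc_in X p v \<gamma>" for \<gamma> v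
  proof -
    have \<gamma>0: "\<gamma> 0 = p" and ev: "eventually (\<lambda>t. \<gamma> t \<in> X) (nhds 0)"
      and der: "(\<gamma> has_derivative (\<lambda>h. h *s v)) (at 0)"
      using \<gamma> unfolding arc_in_def by auto
    have "isCont \<gamma> 0" using der by (rule has_derivative_continuous)
    then have "eventually (\<lambda>t. \<gamma> t \<in> U) (nhds 0)"
      unfolding continuous_at_open eventually_nhds using U \<gamma>0 by metis
    with ev have evXU: "eventually (\<lambda>t. \<gamma> t \<in> X \<inter> U) (nhds 0)"
      by eventually_elim simp
    then obtain S where S: "open S" "0 \<in> S" "\<And>t. t \<in> S \<Longrightarrow> F (\<gamma> t) = f (\<gamma> t)"
      unfolding eventually_nhds using fF by metis
    have "((\<lambda>t. F (\<gamma> t)) has_derivative (\<lambda>h. D (h *s v))) (at 0)"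
      by (rule has_derivative_compose[OF der D[folded \<gamma>0]])
    then have "((\<lambda>t. f (\<gamma> t)) has_derivative (\<lambda>h. h *s D v)) (at 0)"
      unfolding Dc using S by (rule has_derivative_transform_within_open)
    moreover have "eventually (\<lambda>t. f (\<gamma> t) \<in> Y) (nhds 0)"
      by (rule eventually_mono[OF ev]) (use f in \<open>auto simp: analytic_morphism_def\<close>)
    ultimately show ?thesis unfolding arc_in_def by (simp add: \<gamma>0)
  qed
  ultimately show ?thesis by blast
qed

lemma arc_velocity_unique:
  assumes "arc_in V p v \<gamma>" "arc_in W q w \<delta>" "eventually (\<lambda>t. \<gamma> t = \<delta> t) (nhds 0)"
  shows "v = w"
proof -
  obtain S where "open S" "0 \<in> S" "\<And>t. t \<in> S \<Longrightarrow> \<gamma> t = \<delta> t"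
    using assms(3) unfolding eventually_nhds by blast
  with assms(1) have "(\<delta> has_derivative (\<lambda>h. h *s v)) (at 0)"
    unfolding arc_in_def by (blast intro: has_derivative_transform_within_open)
  with assms(2) have "(\<lambda>h. h *s v) = (\<lambda>h. h *s w)"
    unfolding arc_in_def by (blast intro: has_derivative_unique)
  then have "1 *s v = 1 *s w" by (rule fun_cong)
  then show ?thesis by simp
qed

text \<open>Let \<open>D\<close> and \<open>E\<close> be the differentials of local extensions of the two maps. The extensions need
  not be inverse to each other off the two sets, but \<open>E \<circ> D\<close> fixes the velocities of \<open>X\<close>, hence
  their span, which is the whole space. So \<open>D\<close> is an isomorphism that takes the velocities of
  \<open>X\<close> to velocities of \<open>Y\<close>.\<close>

lemma biholomorphic_full_tangent_space:
  fixes X Y :: "(complex ^ 'n::finite) set"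
  assumes bih: "biholomorphic X Y" and p: "p \<in> X" and full: "vec.span (velocities X p) = UNIV"
  obtains q where "q \<in> Y" "zariski_tangent_space Y q = UNIV"
proof -
  from bih obtain f g where f: "analytic_morphism X Y f" and g: "analytic_morphism Y X g"
    and gf: "\<And>x. x \<in> X \<Longrightarrow> g (f x) = x"
    unfolding biholomorphic_def by blast
  have q: "f p \<in> Y" using f p unfolding analytic_morphism_def by blast
  obtain D where D: "Vector_Spaces.linear (*s) (*s) D"
    and D_arc: "\<And>\<gamma> v. arc_in X p v \<gamma> \<Longrightarrow> arc_in Y (f p) (D v) (\<lambda>t. f (\<gamma> t))"
    using arc_push_forward[OF f p] by blast
  obtain E where E: "Vector_Spaces.linear (*s) (*s) E"
    and E_arc: "\<And>\<gamma> v. arc_in Y (f p) v \<gamma> \<Longrightarrow> arc_in X (g (f p)) (E v) (\<lambda>t. g (\<gamma> t))"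
    using arc_push_forward[OF g q] by blast
  have ED: "E (D v) = v" if v: "v \<in> velocities X p" for v
  proof -
    from v obtain \<gamma> where \<gamma>: "arc_in X p v \<gamma>" unfolding velocities_def by blast
    have "eventually (\<lambda>t. g (f (\<gamma> t)) = \<gamma> t) (nhds 0)"
      using \<gamma> gf unfolding arc_in_def by (auto elim: eventually_mono)
    then show ?thesis by (rule arc_velocity_unique[OF E_arc[OF D_arc[OF \<gamma>]] \<gamma>])
  qed
  have "E (D v) = v" for v
  proof -
    have lin: "Vector_Spaces.linear (*s) (*s) (\<lambda>v. E (D v))"
      using Vector_Spaces.linear_compose[OF D E] by (simp add: comp_def)
    have "v \<in> vec.span (velocities X p)" using full by simp
    from vec.linear_eq_on[OF lin vec.linear_ident this ED] show ?thesis .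
  qed
  then have "inj D" by (metis injI)
  then have "surj D" by (rule vec.linear_inj_imp_surj[OF D])
  then have "UNIV = D ` vec.span (velocities X p)" using full by simp
  also have "\<dots> = vec.span (D ` velocities X p)"
    by (rule vec.linear_span_image[OF D, symmetric])
  also have "\<dots> \<subseteq> vec.span (velocities Y (f p))"
    using D_arc unfolding velocities_def by (intro vec.span_mono) blast
  also have "\<dots> \<subseteq> zariski_tangent_space Y (f p)" by (rule span_velocities_tangent)
  finally show ?thesis using q that by blast
qed

section \<open>Irreducibility through rational curves\<close>

text \<open>A curve whose poles are zeros of \<open>q\<close>. A separate exponent for each coordinate avoids
  normalizing to a common denominator.\<close>

definition rational_curve :: "complex poly \<Rightarrow> (complex \<Rightarrow> complex ^ 'n) \<Rightarrow> bool" where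
  "rational_curve q \<gamma> \<longleftrightarrow>
    (\<forall>i. \<exists>P k. \<forall>u. poly q u \<noteq> 0 \<longrightarrow> \<gamma> u $ i = poly P u / poly q u ^ k)"

lemma polynomial_function_on_rational_curve:
  assumes "complex_polynomial_function f" "rational_curve q \<gamma>"
  shows "\<exists>P k. \<forall>u. poly q u \<noteq> 0 \<longrightarrow> f (\<gamma> u) = poly P u / poly q u ^ k"
  using assms(1)
proof induction
  case (coordinate i)
  then show ?case using assms(2) by (simp add: rational_curve_def)
next
  case (const c)
  then show ?case by (intro exI[of _ "[:c:]"] exI[of _ 0]) simp
next
  case (add f g)
  then obtain P Q k l where
    "\<forall>u. poly q u \<noteq> 0 \<longrightarrow> f (\<gamma> u) = poly P u / poly q u ^ k"
    "\<forall>u. poly q u \<noteq> 0 \<longrightarrow> g (\<gamma> u) = poly Q u / poly q u ^ l" by blast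
  then show ?case
    by (intro exI[of _ "P * q ^ l + Q * q ^ k"] exI[of _ "k + l"])
      (simp add: poly_power power_add add_frac_eq)
next
  case (mult f g)
  then obtain P Q k l where
    "\<forall>u. poly q u \<noteq> 0 \<longrightarrow> f (\<gamma> u) = poly P u / poly q u ^ k"
    "\<forall>u. poly q u \<noteq> 0 \<longrightarrow> g (\<gamma> u) = poly Q u / poly q u ^ l" by blast
  then show ?case
    by (intro exI[of _ "P * Q"] exI[of _ "k + l"]) (simp add: power_add)
qed

text \<open>If \<open>S\<close> were the union of smaller sets \<open>A\<close> and \<open>B\<close>, some polynomial \<open>f\<close> would vanish on \<open>A\<close>
  but not at a point \<open>a\<close> of \<open>S\<close>, and some \<open>g\<close> on \<open>B\<close> but not at \<open>b\<close>. Along a rational curve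
  through \<open>a\<close> and \<open>b\<close> the numerators of \<open>f\<close> and \<open>g\<close> are nonzero polynomials in one variable,
  yet \<open>f g\<close> vanishes on the curve.\<close>

lemma irreducible_if_joined_by_rational_curves:
  assumes S: "algebraic_set S" "S \<noteq> {}"
    and joined: "\<And>a b. a \<in> S \<Longrightarrow> b \<in> S \<Longrightarrow> \<exists>q \<gamma> s t. rational_curve q \<gamma> \<and>
      poly q s \<noteq> 0 \<and> poly q t \<noteq> 0 \<and> \<gamma> s = a \<and> \<gamma> t = b \<and> (\<forall>u. poly q u \<noteq> 0 \<longrightarrow> \<gamma> u \<in> S)"
  shows "irreducible_algebraic_set S"
proof -
  have "S = A \<or> S = B" if A: "algebraic_set A" and B: "algebraic_set B" and AB: "S = A \<union> B" for A B
  proof (rule ccontr)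
    assume "\<not> (S = A \<or> S = B)"
    then obtain a b where a: "a \<in> S" "a \<notin> A" and b: "b \<in> S" "b \<notin> B" using AB by blast
    obtain f where f: "complex_polynomial_function f" "f a \<noteq> 0" "\<And>x. x \<in> A \<Longrightarrow> f x = 0"
      using A a unfolding algebraic_set_def by blast
    obtain g where g: "complex_polynomial_function g" "g b \<noteq> 0" "\<And>x. x \<in> B \<Longrightarrow> g x = 0"
      using B b unfolding algebraic_set_def by blast
    obtain q \<gamma> s t where \<gamma>: "rational_curve q \<gamma>" and s: "poly q s \<noteq> 0" "\<gamma> s = a"
      and t: "poly q t \<noteq> 0" "\<gamma> t = b" and in_S: "\<And>u. poly q u \<noteq> 0 \<Longrightarrow> \<gamma> u \<in> S"
      using joined[OF a(1) b(1)] by blast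
    obtain P k where P: "\<And>u. poly q u \<noteq> 0 \<Longrightarrow> f (\<gamma> u) = poly P u / poly q u ^ k"
      using polynomial_function_on_rational_curve[OF f(1) \<gamma>] by blast
    obtain Q l where Q: "\<And>u. poly q u \<noteq> 0 \<Longrightarrow> g (\<gamma> u) = poly Q u / poly q u ^ l"
      using polynomial_function_on_rational_curve[OF g(1) \<gamma>] by blast
    have "P \<noteq> 0" "Q \<noteq> 0" "q \<noteq> 0"
      using P[OF s(1)] Q[OF t(1)] s t f(2) g(2) by auto
    then have "P * Q * q \<noteq> 0" by simp
    then obtain u where u: "poly (P * Q * q) u \<noteq> 0"
      using poly_all_0_iff_0 by blast
    then have "f (\<gamma> u) \<noteq> 0" "g (\<gamma> u) \<noteq> 0" "\<gamma> u \<in> S"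
      using P[of u] Q[of u] in_S[of u] by auto
    then show False using AB f(3) g(3) by blast
  qed
  then show ?thesis using S unfolding irreducible_algebraic_set_def by blast
qed

section \<open>Cylinders\<close>

text \<open>Lift an arc of \<open>S\<close>, and move along a line in the remaining coordinates.\<close>

lemma velocities_cylinderI:
  fixes \<iota> :: "3 \<Rightarrow> 'n::finite"
  assumes inj: "inj \<iota>" and w: "(\<chi> i. v $ \<iota> i) \<in> velocities S (\<chi> i. p $ \<iota> i)"
  shows "v \<in> velocities (cylinder \<iota> S) p"
proof -
  obtain c where c: "arc_in S (\<chi> i. p $ \<iota> i) (\<chi> i. v $ \<iota> i) c"
    using w unfolding velocities_def by blast
  define \<gamma> where "\<gamma> = (\<lambda>t. \<chi> j. if j \<in> range \<iota> then c t $ inv \<iota> j else p $ j + t * v $ j)"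
  have pr: "(\<chi> i. \<gamma> t $ \<iota> i) = c t" for t
    by (simp add: \<gamma>_def vec_eq_iff inj)
  have "arc_in (cylinder \<iota> S) p v \<gamma>"
  proof (rule arc_inI)
    have "c 0 = (\<chi> i. p $ \<iota> i)" using c by (simp add: arc_in_def)
    then show "\<gamma> 0 = p" by (auto simp: \<gamma>_def vec_eq_iff inj)
    show "eventually (\<lambda>t. \<gamma> t \<in> cylinder \<iota> S) (nhds 0)"
      using c by (simp add: cylinder_def pr arc_in_def)
    fix j
    show "((\<lambda>t. \<gamma> t $ j) has_field_derivative v $ j) (at 0)"
    proof (cases "j \<in> range \<iota>")
      case True
      then obtain i where j: "j = \<iota> i" by blast
      have "((\<lambda>t. c t $ i) has_derivative (\<lambda>h. (h *s (\<chi> i. v $ \<iota> i)) $ i)) (at 0)"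
        using c unfolding arc_in_def
        by (intro bounded_linear.has_derivative[OF bounded_linear_vec_nth]) simp
      moreover have "(\<lambda>h. (h *s (\<chi> i. v $ \<iota> i)) $ i) = (*) (v $ j)"
        by (auto simp: j)
      ultimately show ?thesis
        by (simp add: \<gamma>_def j inj has_field_derivative_def)
    next
      case False
      then show ?thesis by (auto simp: \<gamma>_def intro!: derivative_eq_intros)
    qed
  qed
  then show ?thesis unfolding velocities_def by blast
qed

text \<open>By induction over linear combinations in the coordinates selected by \<open>\<iota>\<close>. Vectors that are
  zero in these coordinates are velocities because of the constant arc in \<open>S\<close>.\<close>

lemma span_velocities_cylinder:
  fixes \<iota> :: "3 \<Rightarrow> 'n::finite"
  assumes inj: "inj \<iota>" and p: "(\<chi> i. p $ \<iota> i) \<in> S"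
    and full: "vec.span (velocities S (\<chi> i. p $ \<iota> i)) = UNIV"
  shows "vec.span (velocities (cylinder \<iota> S) p) = UNIV"
proof -
  let ?V = "velocities (cylinder \<iota> S) p"
  have zero: "0 \<in> velocities S (\<chi> i. p $ \<iota> i)"
    using p unfolding velocities_def
    by (auto intro!: exI[of _ "\<lambda>_. (\<chi> i. p $ \<iota> i)"] arc_inI)
  have "\<forall>v. (\<chi> i. v $ \<iota> i) = w \<longrightarrow> v \<in> vec.span ?V"
    if "w \<in> vec.span (velocities S (\<chi> i. p $ \<iota> i))" for w
    using that
  proof (induction w rule: vec.span_induct_alt)
    case base
    show ?case using velocities_cylinderI[OF inj] zero by (metis vec.span_base)
  next
    case (step k x y)
    define x' :: "complex ^ 'n" where "x' = (\<chi> j. if j \<in> range \<iota> then x $ inv \<iota> j else 0)"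
    have pr: "(\<chi> i. x' $ \<iota> i) = x" by (simp add: x'_def vec_eq_iff inj)
    show ?case
    proof (intro allI impI)
      fix v :: "complex ^ 'n"
      assume v: "(\<chi> i. v $ \<iota> i) = k *s x + y"
      have "(\<chi> i. (v - k *s x') $ \<iota> i) = y"
        using v pr by (simp add: vec_eq_iff)
      then have "v - k *s x' \<in> vec.span ?V" using step by blast
      moreover have "x' \<in> vec.span ?V"
        using velocities_cylinderI[OF inj, of x'] step(1) pr by (metis vec.span_base)
      ultimately have "k *s x' + (v - k *s x') \<in> vec.span ?V"
        by (intro vec.span_add vec.span_scale)
      then show "v \<in> vec.span ?V" by simp
    qed
  qed
  then show ?thesis using full by blast
qed

section \<open>The two hypersurfaces\<close>

definition poly1 :: "(3 \<Rightarrow> 'n) \<Rightarrow> complex ^ 'n \<Rightarrow> complex" where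
  "poly1 \<iota> x = (x $ \<iota> 1)^2 * x $ \<iota> 2 + (x $ \<iota> 3)^2 + x $ \<iota> 1 * (x $ \<iota> 3)^2"

definition poly2 :: "(3 \<Rightarrow> 'n) \<Rightarrow> complex ^ 'n \<Rightarrow> complex" where
  "poly2 \<iota> x = (x $ \<iota> 1)^2 * x $ \<iota> 2 + (x $ \<iota> 3)^2 + x $ \<iota> 1"

lemma cylinder_S1: "cylinder \<iota> S1 = {x. poly1 \<iota> x = 0}"
  by (simp add: cylinder_def S1_def poly1_def)

lemma cylinder_S2: "cylinder \<iota> S2 = {x. poly2 \<iota> x = 0}"
  by (simp add: cylinder_def S2_def poly2_def)

lemma cylinder_id: "cylinder id S = S"
  by (simp add: cylinder_def)

lemmas polynomial_intros = complex_polynomial_function.intros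

lemma complex_polynomial_function_poly1: "complex_polynomial_function (poly1 \<iota>)"
  unfolding poly1_def power2_eq_square by (intro polynomial_intros)

lemma complex_polynomial_function_poly2: "complex_polynomial_function (poly2 \<iota>)"
  unfolding poly2_def power2_eq_square by (intro polynomial_intros)

lemma hypersurface_zero_set:
  assumes "complex_polynomial_function f" "f a \<noteq> f b"
  shows "hypersurface {x. f x = 0}"
  unfolding hypersurface_def using assms by (intro exI[of _ f]) auto

lemma hypersurface_cylinder_S1: "hypersurface (cylinder \<iota> S1)"
  unfolding cylinder_S1
  by (rule hypersurface_zero_set[OF complex_polynomial_function_poly1, of _ 0 "\<chi> i. 1"])
    (simp add: poly1_def)

lemma hypersurface_cylinder_S2: "hypersurface (cylinder \<iota> S2)"
  unfolding cylinder_S2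
  by (rule hypersurface_zero_set[OF complex_polynomial_function_poly2, of _ 0 "\<chi> i. 1"])
    (simp add: poly2_def)

lemma hypersurface_imp_algebraic: "hypersurface V \<Longrightarrow> algebraic_set V"
proof -
  assume "hypersurface V"
  then obtain f where "complex_polynomial_function f" "V = {x. f x = 0}"
    unfolding hypersurface_def by blast
  then show ?thesis unfolding algebraic_set_def by (intro exI[of _ "{f}"]) simp
qed

lemma rational_curve3I:
  assumes "\<And>u. \<gamma> u = vector [poly X u / poly q u ^ i, poly Y u / poly q u ^ j, poly Z u / poly q u ^ k]"
  shows "rational_curve q (\<gamma> :: complex \<Rightarrow> complex ^ 3)"
  unfolding rational_curve_def forall_3 assms vector_3 by auto

text \<open>Dividing the equation by \<open>x^2\<close> gives \<open>y = - (1 + x) (z / x)^2\<close>, so \<open>t = z / x\<close> is a parameter. On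
  the line \<open>x = z = 0\<close>, where \<open>s = 0\<close>, opposite values of \<open>t\<close> give the same point: off the origin,
  two branches of the surface cross there.\<close>

lemma S1_parametrized:
  "x \<in> S1 \<longleftrightarrow> (\<exists>s t. x = vector [s, - (1 + s) * t^2, s * t])"
proof
  assume "x \<in> S1"
  then have eq: "(x $ 1)^2 * x $ 2 + (x $ 3)^2 + x $ 1 * (x $ 3)^2 = 0" by (simp add: S1_def)
  show "\<exists>s t. x = vector [s, - (1 + s) * t^2, s * t]"
  proof (cases "x $ 1 = 0")
    case True
    with eq have "x = vector [0, - (1 + 0) * (csqrt (- (x $ 2)))^2, 0 * csqrt (- (x $ 2))]"
      by (simp add: vec_eq_iff forall_3)
    then show ?thesis by blast
  next
    case False
    with eq have "x = vector [x $ 1, - (1 + x $ 1) * (x $ 3 / x $ 1)^2, x $ 1 * (x $ 3 / x $ 1)]"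
      by (simp add: vec_eq_iff forall_3 field_simps) algebra
    then show ?thesis by blast
  qed
next
  assume "\<exists>s t. x = vector [s, - (1 + s) * t^2, s * t]"
  then obtain s t where x: "x = vector [s, - (1 + s) * t^2, s * t]" by blast
  have "s^2 * (- (1 + s) * t^2) + (s * t)^2 + s * (s * t)^2 = 0" by algebra
  then show "x \<in> S1" by (simp only: S1_def x vector_3 mem_Collect_eq)
qed

text \<open>Where \<open>x \<noteq> 0\<close>, the surface is the graph of \<open>y = - (x + z^2) / x^2\<close>; this is the case \<open>s = 1\<close>,
  with \<open>v = - (x + z^2)\<close> and \<open>r = z\<close>. Near a point with \<open>x = 0\<close>, the equation gives
  \<open>x = - z^2 (1 + z^2 v)\<close> and \<open>y = v / (1 + z^2 v)^2\<close>, where \<open>v\<close> replaces \<open>y\<close> as a coordinate; this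
  is the case \<open>r = 1\<close> with \<open>s = z\<close>. The parameter \<open>r\<close> homogenizes, so as to
  treat both charts at once. The admissible parameters are the complement of a hypersurface,
  so the line through two of them meets the excluded set in finitely many points only.\<close>

lemma S2_parametrized:
  "x \<in> S2 \<longleftrightarrow> (\<exists>s r v. r^2 + s^2 * v \<noteq> 0 \<and>
     x = vector [- (s^2 * (r^2 + s^2 * v)), v / (r^2 + s^2 * v)^2, s * r])"
proof
  assume "x \<in> S2"
  then have eq: "(x $ 1)^2 * x $ 2 + (x $ 3)^2 + x $ 1 = 0" by (simp add: S2_def)
  show "\<exists>s r v. r^2 + s^2 * v \<noteq> 0 \<and>
     x = vector [- (s^2 * (r^2 + s^2 * v)), v / (r^2 + s^2 * v)^2, s * r]"
  proof (cases "x $ 1 = 0")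
    case True
    with eq show ?thesis
      by (intro exI[of _ 0] exI[of _ 1] exI[of _ "x $ 2"]) (simp add: vec_eq_iff forall_3)
  next
    case False
    moreover have "x $ 2 * (x $ 1)^2 = - (x $ 1) - (x $ 3)^2" using eq by algebra
    ultimately show ?thesis
      by (intro exI[of _ 1] exI[of _ "x $ 3"] exI[of _ "- (x $ 1) - (x $ 3)^2"])
        (simp add: vec_eq_iff forall_3 eq_divide_eq)
  qed
next
  assume "\<exists>s r v. r^2 + s^2 * v \<noteq> 0 \<and>
     x = vector [- (s^2 * (r^2 + s^2 * v)), v / (r^2 + s^2 * v)^2, s * r]"
  then obtain s r v q where q: "q = r^2 + s^2 * v" "q \<noteq> 0"
    and x: "x = vector [- (s^2 * q), v / q^2, s * r]" by blast
  have "(- (s^2 * q))^2 * (v / q^2) = s^4 * v"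
    using q(2) by (simp add: field_simps)
  then have "(- (s^2 * q))^2 * (v / q^2) + (s * r)^2 + - (s^2 * q) = s^4 * v + (s * r)^2 + - (s^2 * q)"
    by simp
  also have "\<dots> = 0" unfolding q(1) by algebra
  finally show "x \<in> S2" by (simp only: S2_def x vector_3 mem_Collect_eq)
qed

lemma irreducible_S1: "irreducible_algebraic_set S1"
proof (rule irreducible_if_joined_by_rational_curves)
  show "algebraic_set S1"
    using hypersurface_cylinder_S1[of id] by (simp add: cylinder_id hypersurface_imp_algebraic)
  show "S1 \<noteq> {}" using S1_parametrized by blast
next
  fix a b assume "a \<in> S1" "b \<in> S1"
  then obtain s t s' t' where a: "a = vector [s, - (1 + s) * t^2, s * t]"
    and b: "b = vector [s', - (1 + s') * t'^2, s' * t']" unfolding S1_parametrized by blast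
  define \<sigma> \<tau> where "\<sigma> = [:s, s' - s:]" and "\<tau> = [:t, t' - t:]"
  define \<gamma> :: "complex \<Rightarrow> complex ^ 3" where
    "\<gamma> = (\<lambda>u. vector [poly \<sigma> u, - (1 + poly \<sigma> u) * (poly \<tau> u)^2, poly \<sigma> u * poly \<tau> u])"
  have "rational_curve 1 \<gamma>"
    by (rule rational_curve3I[of _ \<sigma> _ 0 "- (1 + \<sigma>) * \<tau>^2" 0 "\<sigma> * \<tau>" 0]) (simp add: \<gamma>_def)
  moreover have "poly \<sigma> 0 = s" "poly \<sigma> 1 = s'" "poly \<tau> 0 = t" "poly \<tau> 1 = t'"
    by (simp_all add: \<sigma>_def \<tau>_def)
  then have "\<gamma> 0 = a" "\<gamma> 1 = b" by (simp_all only: \<gamma>_def a b)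
  moreover have "\<gamma> u \<in> S1" for u unfolding \<gamma>_def S1_parametrized by blast
  ultimately show "\<exists>q \<gamma> s t. rational_curve q \<gamma> \<and>
      poly q s \<noteq> 0 \<and> poly q t \<noteq> 0 \<and> \<gamma> s = a \<and> \<gamma> t = b \<and> (\<forall>u. poly q u \<noteq> 0 \<longrightarrow> \<gamma> u \<in> S1)"
    by (intro exI[of _ 1] exI[of _ \<gamma>] exI[of _ 0]) auto
qed

lemma irreducible_S2: "irreducible_algebraic_set S2"
proof (rule irreducible_if_joined_by_rational_curves)
  show "algebraic_set S2"
    using hypersurface_cylinder_S2[of id] by (simp add: cylinder_id hypersurface_imp_algebraic)
  have "0 \<in> S2" by (simp add: S2_def)
  then show "S2 \<noteq> {}" by blast
next
  fix a b assume "a \<in> S2" "b \<in> S2"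
  then obtain s r v s' r' v' where
    a: "r^2 + s^2 * v \<noteq> 0" "a = vector [- (s^2 * (r^2 + s^2 * v)), v / (r^2 + s^2 * v)^2, s * r]" and
    b: "r'^2 + s'^2 * v' \<noteq> 0"
      "b = vector [- (s'^2 * (r'^2 + s'^2 * v')), v' / (r'^2 + s'^2 * v')^2, s' * r']"
    unfolding S2_parametrized by blast
  define \<sigma> \<rho> \<nu> where "\<sigma> = [:s, s' - s:]" and "\<rho> = [:r, r' - r:]" and "\<nu> = [:v, v' - v:]"
  define q where "q = \<rho>^2 + \<sigma>^2 * \<nu>"
  define \<gamma> :: "complex \<Rightarrow> complex ^ 3" where
    "\<gamma> = (\<lambda>u. vector [- ((poly \<sigma> u)^2 * poly q u), poly \<nu> u / (poly q u)^2, poly \<sigma> u * poly \<rho> u])"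
  have "rational_curve q \<gamma>"
    by (rule rational_curve3I[of _ "- (\<sigma>^2 * q)" _ 0 "\<nu>" 2 "\<sigma> * \<rho>" 0])
      (simp add: \<gamma>_def)
  moreover have ends: "poly \<sigma> 0 = s" "poly \<sigma> 1 = s'" "poly \<rho> 0 = r" "poly \<rho> 1 = r'"
      "poly \<nu> 0 = v" "poly \<nu> 1 = v'"
    by (simp_all add: \<sigma>_def \<rho>_def \<nu>_def)
  have q_ends: "poly q 0 = r^2 + s^2 * v" "poly q 1 = r'^2 + s'^2 * v'"
    by (simp_all add: q_def ends)
  have "\<gamma> 0 = a" "\<gamma> 1 = b"
    by (simp_all only: \<gamma>_def a(2) b(2) ends q_ends)
  moreover have "poly q 0 \<noteq> 0" "poly q 1 \<noteq> 0" using a(1) b(1) by (simp_all only: q_ends not_False_eq_True)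
  moreover have "\<gamma> u \<in> S2" if "poly q u \<noteq> 0" for u
    using that unfolding \<gamma>_def S2_parametrized
    by (intro exI[of _ "poly \<sigma> u"] exI[of _ "poly \<rho> u"] exI[of _ "poly \<nu> u"]) (simp add: q_def)
  ultimately show "\<exists>q \<gamma> s t. rational_curve q \<gamma> \<and>
      poly q s \<noteq> 0 \<and> poly q t \<noteq> 0 \<and> \<gamma> s = a \<and> \<gamma> t = b \<and> (\<forall>u. poly q u \<noteq> 0 \<longrightarrow> \<gamma> u \<in> S2)"
    by blast
qed

text \<open>The arcs \<open>t = 1\<close> and \<open>t = - 1\<close> of the parametrization, with varying \<open>s\<close>, run on the two branches
  through this point.\<close>

lemma span_velocities_S1: "vec.span (velocities S1 (vector [0, -1, 0])) = UNIV"
proof -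
  let ?V = "velocities S1 (vector [0, -1, 0])"
  have branch: "vector [1, -1, e] \<in> ?V" if "e^2 = 1" for e :: complex
  proof -
    have "vector [t, - (1 + t) * e^2, t * e] \<in> S1" for t
      unfolding S1_parametrized by blast
    then have "arc_in S1 (vector [0, -1, 0]) (vector [1, -1, e])
        (\<lambda>t. vector [t, - (1 + t) * e^2, t * e])"
      by (intro arc_in_vector_3I) (auto simp: that intro!: derivative_eq_intros)
    then show ?thesis unfolding velocities_def by blast
  qed
  have "arc_in S1 (vector [0, -1, 0]) (vector [0, 1, 0]) (\<lambda>t. vector [0, -1 + t, 0])"
    by (intro arc_in_vector_3I) (auto simp: S1_def intro!: derivative_eq_intros)
  then have axis: "vector [0, 1, 0] \<in> ?V" unfolding velocities_def by blast
  have "v \<in> vec.span ?V" for v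
  proof -
    have "v = ((v $ 1 + v $ 3) / 2) *s vector [1, -1, 1] + ((v $ 1 - v $ 3) / 2) *s vector [1, -1, -1]
        + (v $ 1 + v $ 2) *s vector [0, 1, 0]"
      by (simp add: vec_eq_iff forall_3 field_simps)
    also have "\<dots> \<in> vec.span ?V"
      using branch[of 1] branch[of "-1"] axis
      by (intro vec.span_add vec.span_scale vec.span_base) auto
    finally show ?thesis .
  qed
  then show ?thesis by blast
qed

text \<open>On the chart \<open>r = 1\<close> of the parametrization, for \<open>x = 0\<close>, and on the graph over the \<open>(x, z)\<close>-plane,
  for \<open>x \<noteq> 0\<close>, move linearly in the two parameters. In the second case the hypothesis on \<open>w\<close>
  says that the remaining component of the velocity is \<open>w $ 2\<close>.\<close>

lemma kernel_subset_velocities_S2: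
  assumes p: "p \<in> S2"
    and w: "(2 * p $ 1 * p $ 2 + 1) * w $ 1 + (p $ 1)^2 * w $ 2 + 2 * p $ 3 * w $ 3 = 0"
  shows "w \<in> velocities S2 p"
proof -
  have eq: "(p $ 1)^2 * p $ 2 + (p $ 3)^2 + p $ 1 = 0" using p by (simp add: S2_def)
  have "\<exists>\<gamma>. arc_in S2 p w \<gamma>"
  proof (cases "p $ 1 = 0")
    case True
    then have p3: "p $ 3 = 0" and w1: "w $ 1 = 0" using eq w by auto
    define s where "s = (\<lambda>t. t * w $ 3)"
    define v where "v = (\<lambda>t. p $ 2 + t * w $ 2)"
    define q where "q = (\<lambda>t. 1 + (s t)^2 * v t)"
    have ds: "(s has_field_derivative w $ 3) (at 0)" and dv: "(v has_field_derivative w $ 2) (at 0)"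
      unfolding s_def v_def by (auto intro!: derivative_eq_intros)
    have s0: "s 0 = 0" and v0: "v 0 = p $ 2" and q0: "q 0 = 1" by (simp_all add: s_def v_def q_def)
    have dq: "(q has_field_derivative 0) (at 0)"
      unfolding q_def by (rule derivative_eq_intros ds dv refl | simp add: s0)+
    have "arc_in S2 p w (\<lambda>t. vector [- ((s t)^2 * q t), v t / (q t)^2, s t])"
    proof (rule arc_in_vector_3I)
      show "vector [- ((s 0)^2 * q 0), v 0 / (q 0)^2, s 0] = p" by (simp add: s0 v0 q0 vec_eq_iff forall_3 True p3)
      have "open {t. q t \<noteq> 0}" unfolding q_def s_def v_def
        by (intro open_Collect_neq continuous_intros)
      moreover have "vector [- ((s t)^2 * q t), v t / (q t)^2, s t] \<in> S2" if "q t \<noteq> 0" for t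
        unfolding S2_parametrized using that
        by (intro exI[of _ "s t"] exI[of _ 1] exI[of _ "v t"]) (simp add: q_def)
      ultimately show "eventually (\<lambda>t. vector [- ((s t)^2 * q t), v t / (q t)^2, s t] \<in> S2) (nhds 0)"
        unfolding eventually_nhds using q0 by (intro exI[of _ "{t. q t \<noteq> 0}"]) simp
      have "((\<lambda>t. - ((s t)^2 * q t)) has_field_derivative 0) (at 0)"
        by (rule derivative_eq_intros ds dq refl | simp add: s0)+
      then show "((\<lambda>t. - ((s t)^2 * q t)) has_field_derivative w $ 1) (at 0)" by (simp only: w1)
      show "((\<lambda>t. v t / (q t)^2) has_field_derivative w $ 2) (at 0)"
        by (rule derivative_eq_intros dv dq refl | simp add: q0)+
      show "(s has_field_derivative w $ 3) (at 0)" by (rule ds)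
    qed
    then show ?thesis by blast
  next
    case False
    define x where "x = (\<lambda>t. p $ 1 + t * w $ 1)"
    define z where "z = (\<lambda>t. p $ 3 + t * w $ 3)"
    have dx: "(x has_field_derivative w $ 1) (at 0)" and dz: "(z has_field_derivative w $ 3) (at 0)"
      unfolding x_def z_def by (auto intro!: derivative_eq_intros)
    have x0: "x 0 = p $ 1" and z0: "z 0 = p $ 3" by (simp_all add: x_def z_def)
    have "arc_in S2 p w (\<lambda>t. vector [x t, - ((z t)^2 + x t) / (x t)^2, z t])"
    proof (rule arc_in_vector_3I)
      have "- ((p $ 3)^2 + p $ 1) = p $ 2 * (p $ 1)^2" using eq by algebra
      then have y0: "- ((p $ 3)^2 + p $ 1) / (p $ 1)^2 = p $ 2"
        using False by (simp only: nonzero_mult_div_cancel_right) simp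
      then show "vector [x 0, - ((z 0)^2 + x 0) / (x 0)^2, z 0] = p" by (simp add: x0 z0 vec_eq_iff forall_3)
      have "open {t. x t \<noteq> 0}" unfolding x_def
        by (intro open_Collect_neq continuous_intros)
      moreover have "vector [x t, - ((z t)^2 + x t) / (x t)^2, z t] \<in> S2" if "x t \<noteq> 0" for t
        using that by (simp add: S2_def)
      ultimately show "eventually (\<lambda>t. vector [x t, - ((z t)^2 + x t) / (x t)^2, z t] \<in> S2) (nhds 0)"
        unfolding eventually_nhds using x0 False by (intro exI[of _ "{t. x t \<noteq> 0}"]) simp
      have "((\<lambda>t. - ((z t)^2 + x t) / (x t)^2) has_field_derivative
          (- (2 * p $ 3 * w $ 3 + w $ 1) * (p $ 1)^2 + ((p $ 3)^2 + p $ 1) * (2 * p $ 1 * w $ 1))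
            / ((p $ 1)^2 * (p $ 1)^2)) (at 0)"
        by (rule derivative_eq_intros dx dz refl | simp add: x0 z0 False algebra_simps)+
      moreover have "(- (2 * p $ 3 * w $ 3 + w $ 1) * (p $ 1)^2 + ((p $ 3)^2 + p $ 1) * (2 * p $ 1 * w $ 1))
          = w $ 2 * ((p $ 1)^2 * (p $ 1)^2)"
        using eq w by algebra
      ultimately show "((\<lambda>t. - ((z t)^2 + x t) / (x t)^2) has_field_derivative w $ 2) (at 0)"
        using False by simp
      show "(x has_field_derivative w $ 1) (at 0)" by (rule dx)
      show "(z has_field_derivative w $ 3) (at 0)" by (rule dz)
    qed
    then show ?thesis by blast
  qed
  then show ?thesis by (simp add: velocities_def)
qed

text \<open>The differential of the equation is nowhere zero: its coefficient at \<open>dy\<close> is \<open>x^2\<close>, and its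
  coefficient at \<open>dx\<close> is 1 where \<open>x = 0\<close>.\<close>

lemma smooth_cylinder_S2:
  fixes \<iota> :: "3 \<Rightarrow> 'n::finite"
  assumes inj: "inj \<iota>"
  shows "smooth_hypersurface (cylinder \<iota> S2)"
proof -
  have "\<not> singular_point (cylinder \<iota> S2) p" for p :: "complex ^ 'n"
  proof (cases "p \<in> cylinder \<iota> S2")
    case False
    then show ?thesis by (simp add: singular_point_def)
  next
    case True
    define D where "D = (\<lambda>v. (2 * p $ \<iota> 1 * p $ \<iota> 2 + 1) * v $ \<iota> 1 + (p $ \<iota> 1)^2 * v $ \<iota> 2
        + 2 * p $ \<iota> 3 * v $ \<iota> 3)"
    show ?thesis
    proof (rule nonsingular_if_kernel_velocities)
      show "poly2 \<iota> \<in> vanishing_ideal (cylinder \<iota> S2)"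
        by (simp add: vanishing_ideal_def complex_polynomial_function_poly2 cylinder_S2)
      have coord: "((\<lambda>x. x $ i) has_derivative (\<lambda>v. v $ i)) (at p)" for i
        by (rule bounded_linear_imp_has_derivative) (rule bounded_linear_vec_nth)
      show "(poly2 \<iota> has_derivative D) (at p)"
        unfolding poly2_def D_def
        by (rule derivative_eq_intros coord refl | simp add: algebra_simps)+
      show "D (if p $ \<iota> 1 = 0 then axis (\<iota> 1) 1 else axis (\<iota> 2) 1 :: complex ^ 'n) \<noteq> 0"
        using inj by (simp add: D_def axis_def inj_eq)
      show "v \<in> velocities (cylinder \<iota> S2) p" if "D v = 0" for v
        using that True
        by (intro velocities_cylinderI[OF inj] kernel_subset_velocities_S2) (simp_all add: cylinder_def D_def)
    qed
  qed
  then show ?thesis by (simp add: smooth_hypersurface_def hypersurface_cylinder_S2)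
qed

lemma S1_cylinder_full_point:
  fixes \<iota> :: "3 \<Rightarrow> 'n::finite"
  assumes inj: "inj \<iota>"
  obtains p where "p \<in> cylinder \<iota> S1" "vec.span (velocities (cylinder \<iota> S1) p) = UNIV"
proof -
  define p :: "complex ^ 'n" where "p = (\<chi> j. if j = \<iota> 2 then -1 else 0)"
  have pr: "(\<chi> i. p $ \<iota> i) = vector [0, -1, 0]"
    using inj by (simp add: p_def vec_eq_iff forall_3 inj_eq)
  have S1: "(\<chi> i. p $ \<iota> i) \<in> S1" by (simp add: pr S1_def)
  show ?thesis
  proof (rule that)
    show "p \<in> cylinder \<iota> S1" using S1 by (simp add: cylinder_def)
    show "vec.span (velocities (cylinder \<iota> S1) p) = UNIV"
      by (rule span_velocities_cylinder[OF inj S1]) (simp add: pr span_velocities_S1)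
  qed
qed

section \<open>The isomorphism of the complements\<close>

lemma regular_function_quotient:
  assumes "complex_polynomial_function g" "complex_polynomial_function h" "\<And>x. x \<in> U \<Longrightarrow> h x \<noteq> 0"
  shows "regular_function_on U (\<lambda>x. g x / h x)"
  using assms unfolding regular_function_on_def by blast

lemma regular_function_polynomial:
  "complex_polynomial_function g \<Longrightarrow> regular_function_on U g"
  using regular_function_quotient[of g "\<lambda>_. 1"] by (simp add: polynomial_intros)

lemma complex_polynomial_function_diff:
  assumes "complex_polynomial_function f" "complex_polynomial_function g"
  shows "complex_polynomial_function (\<lambda>x. f x - g x)"
  using add[OF assms(1) mult[OF const[of "-1"] assms(2)]] by simp

text \<open>Both maps fix \<open>z\<close> and the coordinates outside the range of \<open>\<iota>\<close>; in \<open>\<phi>\<close> the value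
  \<open>c\<close> of the first polynomial, and in \<open>\<psi>\<close> that of the second, plays the role of a unit by which
  \<open>x\<close> is rescaled. The map \<open>\<phi>\<close> carries the first polynomial to the second, so that \<open>\<psi>\<close> reads
  off the same \<open>c\<close>.\<close>

lemma isomorphic_complements:
  fixes \<iota> :: "3 \<Rightarrow> 'n::finite"
  assumes inj: "inj \<iota>"
  shows "isomorphic_varieties (- cylinder \<iota> S1) (- cylinder \<iota> S2)"
proof -
  have ne [simp]: "\<iota> 1 \<noteq> \<iota> 2" "\<iota> 2 \<noteq> \<iota> 1" "\<iota> 1 \<noteq> \<iota> 3" "\<iota> 3 \<noteq> \<iota> 1" "\<iota> 2 \<noteq> \<iota> 3" "\<iota> 3 \<noteq> \<iota> 2"
    using inj by (simp_all add: inj_eq)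
  define \<phi> :: "complex ^ 'n \<Rightarrow> complex ^ 'n" where
    "\<phi> = (\<lambda>x. \<chi> j. if j = \<iota> 1 then poly1 \<iota> x * x $ \<iota> 1
      else if j = \<iota> 2 then ((1 - x $ \<iota> 1) * x $ \<iota> 2 - x $ \<iota> 3 * x $ \<iota> 3) / (poly1 \<iota> x * poly1 \<iota> x)
      else x $ j)"
  define \<psi> :: "complex ^ 'n \<Rightarrow> complex ^ 'n" where
    "\<psi> = (\<lambda>x. \<chi> j. if j = \<iota> 1 then x $ \<iota> 1 / poly2 \<iota> x
      else if j = \<iota> 2 then poly2 \<iota> x * (poly2 \<iota> x * x $ \<iota> 2 + x $ \<iota> 1 * x $ \<iota> 2 + 1)
      else x $ j)"
  have poly2_\<phi>: "poly2 \<iota> (\<phi> x) = poly1 \<iota> x" if c0: "poly1 \<iota> x \<noteq> 0" for x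
  proof -
    have "(c * x1)^2 * (B / (c * c)) = x1^2 * B" if "c \<noteq> 0" for c x1 B :: complex
      using that by (simp add: field_simps power2_eq_square)
    from this[OF c0] have "poly2 \<iota> (\<phi> x) = (x $ \<iota> 1)^2 * ((1 - x $ \<iota> 1) * x $ \<iota> 2 - x $ \<iota> 3 * x $ \<iota> 3)
        + (x $ \<iota> 3)^2 + poly1 \<iota> x * x $ \<iota> 1"
      by (simp add: poly2_def \<phi>_def)
    also have "\<dots> = poly1 \<iota> x" unfolding poly1_def by algebra
    finally show ?thesis .
  qed
  have poly1_\<psi>: "poly1 \<iota> (\<psi> y) = poly2 \<iota> y" if c0: "poly2 \<iota> y \<noteq> 0" for y
  proof -
    define c where "c = poly2 \<iota> y"
    have c: "c = (y $ \<iota> 1)^2 * y $ \<iota> 2 + (y $ \<iota> 3)^2 + y $ \<iota> 1" by (simp add: c_def poly2_def)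
    have "(x / c)^2 * (c * B) + z^2 + x / c * z^2 = (x^2 * B + (c + x) * z^2) / c" for x B z
      using c0 by (simp add: c_def[symmetric] field_simps power2_eq_square)
    then have "poly1 \<iota> (\<psi> y) = ((y $ \<iota> 1)^2 * (c * y $ \<iota> 2 + y $ \<iota> 1 * y $ \<iota> 2 + 1)
        + (c + y $ \<iota> 1) * (y $ \<iota> 3)^2) / c"
      by (simp add: poly1_def \<psi>_def c_def[symmetric])
    also have "(y $ \<iota> 1)^2 * (c * y $ \<iota> 2 + y $ \<iota> 1 * y $ \<iota> 2 + 1) + (c + y $ \<iota> 1) * (y $ \<iota> 3)^2 = c * c"
      using c by algebra
    finally show ?thesis using c0 by (simp add: c_def)
  qed
  have \<psi>\<phi>: "\<psi> (\<phi> x) = x" if c0: "poly1 \<iota> x \<noteq> 0" for x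
  proof -
    define c where "c = poly1 \<iota> x"
    have c: "c = (x $ \<iota> 1)^2 * x $ \<iota> 2 + (x $ \<iota> 3)^2 + x $ \<iota> 1 * (x $ \<iota> 3)^2" by (simp add: c_def poly1_def)
    have "c * (c * (B / (c * c)) + c * x1 * (B / (c * c)) + 1) = (1 + x1) * B + c" for x1 B
      using c0 by (simp add: c_def[symmetric] field_simps)
    then have "\<psi> (\<phi> x) $ \<iota> 2 = (1 + x $ \<iota> 1) * ((1 - x $ \<iota> 1) * x $ \<iota> 2 - x $ \<iota> 3 * x $ \<iota> 3) + c"
      using c0 by (simp add: \<psi>_def poly2_\<phi>) (simp add: \<phi>_def c_def)
    also have "\<dots> = x $ \<iota> 2" using c by algebra
    finally have "\<psi> (\<phi> x) $ \<iota> 2 = x $ \<iota> 2" .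
    moreover have "\<psi> (\<phi> x) $ j = x $ j" if "j \<noteq> \<iota> 2" for j
      using c0 that by (simp add: \<psi>_def poly2_\<phi>) (simp add: \<phi>_def)
    ultimately show ?thesis unfolding vec_eq_iff by metis
  qed
  have \<phi>\<psi>: "\<phi> (\<psi> y) = y" if c0: "poly2 \<iota> y \<noteq> 0" for y
  proof -
    define c where "c = poly2 \<iota> y"
    have c: "c = (y $ \<iota> 1)^2 * y $ \<iota> 2 + (y $ \<iota> 3)^2 + y $ \<iota> 1" by (simp add: c_def poly2_def)
    have "((1 - x / c) * (c * B) - z * z) / (c * c) = ((c - x) * B - z * z) / (c * c)" for x B z
      using c0 by (simp add: c_def[symmetric] field_simps)
    then have "\<phi> (\<psi> y) $ \<iota> 2 =
        ((c - y $ \<iota> 1) * (c * y $ \<iota> 2 + y $ \<iota> 1 * y $ \<iota> 2 + 1) - y $ \<iota> 3 * y $ \<iota> 3) / (c * c)"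
      using c0 by (simp add: \<phi>_def poly1_\<psi>) (simp add: \<psi>_def c_def)
    also have "(c - y $ \<iota> 1) * (c * y $ \<iota> 2 + y $ \<iota> 1 * y $ \<iota> 2 + 1) - y $ \<iota> 3 * y $ \<iota> 3 = y $ \<iota> 2 * (c * c)"
      using c by algebra
    finally have "\<phi> (\<psi> y) $ \<iota> 2 = y $ \<iota> 2" using c0 by (simp add: c_def)
    moreover have "\<phi> (\<psi> y) $ j = y $ j" if "j \<noteq> \<iota> 2" for j
      using c0 that by (simp add: \<phi>_def poly1_\<psi>) (simp add: \<psi>_def)
    ultimately show ?thesis unfolding vec_eq_iff by metis
  qed
  note pintros = polynomial_intros complex_polynomial_function_diff
    complex_polynomial_function_poly1 complex_polynomial_function_poly2
  have "algebraic_morphism (- cylinder \<iota> S1) (- cylinder \<iota> S2) \<phi>"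
    unfolding algebraic_morphism_def
  proof (intro conjI allI)
    show "\<phi> ` (- cylinder \<iota> S1) \<subseteq> - cylinder \<iota> S2"
      by (auto simp: cylinder_S1 cylinder_S2) (metis poly2_\<phi>)
    fix j
    show "regular_function_on (- cylinder \<iota> S1) (\<lambda>x. \<phi> x $ j)"
    proof -
      consider "j = \<iota> 1" | "j = \<iota> 2" | "j \<noteq> \<iota> 1" "j \<noteq> \<iota> 2" by blast
      then show ?thesis
      proof cases
        case 1
        then show ?thesis
          by (auto simp: \<phi>_def cylinder_S1 intro!: regular_function_polynomial pintros)
      next
        case 2
        then show ?thesis
          by (auto simp: \<phi>_def cylinder_S1 intro!: regular_function_quotient pintros)
      next
        case 3
        then show ?thesis
          by (auto simp: \<phi>_def cylinder_S1 intro!: regular_function_polynomial pintros)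
      qed
    qed
  qed
  moreover have "algebraic_morphism (- cylinder \<iota> S2) (- cylinder \<iota> S1) \<psi>"
    unfolding algebraic_morphism_def
  proof (intro conjI allI)
    show "\<psi> ` (- cylinder \<iota> S2) \<subseteq> - cylinder \<iota> S1"
      by (auto simp: cylinder_S1 cylinder_S2) (metis poly1_\<psi>)
    fix j
    show "regular_function_on (- cylinder \<iota> S2) (\<lambda>x. \<psi> x $ j)"
    proof -
      consider "j = \<iota> 1" | "j = \<iota> 2" | "j \<noteq> \<iota> 1" "j \<noteq> \<iota> 2" by blast
      then show ?thesis
      proof cases
        case 1
        then show ?thesis
          by (auto simp: \<psi>_def cylinder_S2 intro!: regular_function_quotient pintros)
      next
        case 2
        then show ?thesis
          by (auto simp: \<psi>_def cylinder_S2 intro!: regular_function_polynomial pintros)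
      next
        case 3
        then show ?thesis
          by (auto simp: \<psi>_def cylinder_S2 intro!: regular_function_polynomial pintros)
      qed
    qed
  qed
  ultimately show ?thesis
    unfolding isomorphic_varieties_def using \<psi>\<phi> \<phi>\<psi>
    by (intro exI[of _ \<phi>] exI[of _ \<psi>]) (auto simp: cylinder_S1 cylinder_S2)
qed

theorem proposition3p4:
  fixes m' :: nat and \<iota> :: "3 \<Rightarrow> 'n::finite"
  assumes "CARD('n) = m' + 3" and "inj \<iota>"
  shows "hypersurface S1 \<and> irreducible_algebraic_set S1 \<and>
    hypersurface S2 \<and> irreducible_algebraic_set S2 \<and>
    hypersurface (cylinder \<iota> S1) \<and> hypersurface (cylinder \<iota> S2) \<and>
    isomorphic_varieties (- cylinder \<iota> S1) (- cylinder \<iota> S2) \<and>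
    singular_hypersurface (cylinder \<iota> S1) \<and>
    smooth_hypersurface (cylinder \<iota> S2) \<and>
    \<not> biholomorphic (cylinder \<iota> S1) (cylinder \<iota> S2)"
proof (intro conjI)
  show "hypersurface S1" "hypersurface S2"
    using hypersurface_cylinder_S1[of id] hypersurface_cylinder_S2[of id]
    by (simp_all add: cylinder_id)
  show "irreducible_algebraic_set S1" by (rule irreducible_S1)
  show "irreducible_algebraic_set S2" by (rule irreducible_S2)
  show "hypersurface (cylinder \<iota> S1)" by (rule hypersurface_cylinder_S1)
  show "hypersurface (cylinder \<iota> S2)" by (rule hypersurface_cylinder_S2)
  show "isomorphic_varieties (- cylinder \<iota> S1) (- cylinder \<iota> S2)"
    by (rule isomorphic_complements[OF assms(2)])
  show smooth: "smooth_hypersurface (cylinder \<iota> S2)"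
    by (rule smooth_cylinder_S2[OF assms(2)])
  obtain p where p: "p \<in> cylinder \<iota> S1" "vec.span (velocities (cylinder \<iota> S1) p) = UNIV"
    using S1_cylinder_full_point[OF assms(2)] .
  have "zariski_tangent_space (cylinder \<iota> S1) p = UNIV"
    using span_velocities_tangent[of "cylinder \<iota> S1" p] p(2) by auto
  then show "singular_hypersurface (cylinder \<iota> S1)"
    using singular_if_tangent_UNIV[OF p(1)]
    by (auto simp: singular_hypersurface_def hypersurface_cylinder_S1)
  show "\<not> biholomorphic (cylinder \<iota> S1) (cylinder \<iota> S2)"
  proof
    assume "biholomorphic (cylinder \<iota> S1) (cylinder \<iota> S2)"
    from biholomorphic_full_tangent_space[OF this p]
    obtain q where "q \<in> cylinder \<iota> S2" "zariski_tangent_space (cylinder \<iota> S2) q = UNIV" .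
    then show False
      using singular_if_tangent_UNIV smooth by (auto simp: smooth_hypersurface_def)
  qed
qed

end
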